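(* Let $\Omega=(0,1)\times(0,1)$ and let the diffusion matrix $\mathbb{D}=\begin{bmatrix} a & b\\ b& c\end{bmatrix}$ be continuous on $\overline{\Omega}$ and symmetric and uniformly positive definite on $\Omega$. Consider the boundary value problem $-\nabla\cdot(\mathbb{D}\nabla u)=f$ in $\Omega$, $u=g$ on $\partial\Omega$, and the uniform mesh $(x_j,y_k)=(jh,kh)$, $j,k=0,\dots,N$, $h=1/N$. If $$a(x,y)>|b(x,y)|,\qquad c(x,y)>|b(x,y)|,\qquad\forall (x,y)\in\Omega,$$ and $h$ is sufficiently small (i.e. there is $h_0>0$ such that this holds for all such $h\le h_0$), then a monotone finite difference scheme for this problem can be constructed based on a three-by-three stencil and central finite differences (as defined in the context).
   Context: Uniformly positive definite on $\Omega$ means there is $\lambda>0$ with $\xi^T\mathbb{D}(x,y)\xi\ge\lambda|\xi|^2$ for all $\xi\in\mathbb{R}^2$, $(x,y)\in\Omega$. Scheme based on a three-by-three stencil and central finite differences. At each interior mesh point $P=(x_j,y_k)$, $1\le j,k\le N-1$, the stencil consists of the mesh points $(x_{j+r},y_{k+s})$, $r,s\in\{-1,0,1\}$. The splitting directions are the two diagonals, $\tan\beta_1=1$ and $\tan\beta_2=-1$ ($\beta_1=\pi/4$, $\beta_2=-\pi/4$). Put $$\gamma_0=\begin{cases} a-b\cot\beta_1, & b\ge 0\\ a-b\cot\beta_2, & b<0\end{cases}\quad \gamma_1^+=\begin{cases}\frac{b}{\cos\beta_1\sin\beta_1}, & b\ge 0\\ 0, & b<0\end{cases}\quad \gamma_1^-=\begin{cases}0,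 & b\ge 0\\ \frac{b}{\cos\beta_2\sin\beta_2}, & b<0\end{cases}\quad \gamma_2=\begin{cases} c-b\tan\beta_1, & b\ge 0\\ c-b\tan\beta_2, & b<0\end{cases}$$ With $\partial_\beta=\cos\beta\,\partial_x+\sin\beta\,\partial_y$, the operator is split as $$\nabla\cdot(\mathbb{D}\nabla u)=\partial_x(\gamma_0\partial_xu)+\partial_{\beta_1}(\gamma_1^+\partial_{\beta_1}u)+\partial_{\beta_2}(\gamma_1^-\partial_{\beta_2}u)+\partial_y(\gamma_2\partial_yu),$$ and each term $\partial_e(\gamma\,\partial_eu)(P)$, with $e$ the corresponding unit direction, is replaced by the three-point central difference $$\frac{1}{s^2}\Big[\gamma\!\left(P+\tfrac{s}{2}e\right)\big(u(P+se)-u(P)\big)-\gamma\!\left(P-\tfrac{s}{2}e\right)\big(u(P)-u(P-se)\big)\Big],$$ where $s=h$ for the $x$- and $y$-terms and $s=\sqrt2\,h$ for the two diagonal terms (so $P\pm se$ are always stencil points). Values of $u$ at mesh points of $\partial\Omega$ are given by $g$; the unknowns are the values at interior mesh points, and the equation at $P$ is that minus the sum of the four difference expressions equals $f(P)$. The scheme is called monotone if the coefficient matrix of the resulting linear system for the interior unknowns is an $M$-matrix (nonpositive off-diagonal entries, nonsingular, entrywise nonnegative inverse). *)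

theory Defs
  imports "HOL-Analysis.Analysis" "Jordan_Normal_Form.Matrix"
begin

definition Omega :: "(real \<times> real) set" where
  "Omega = {0<..<1} \<times> {0<..<1}"

definition uniformly_positive_definite_on ::
    "(real \<times> real) set \<Rightarrow> (real \<times> real \<Rightarrow> real ^ 2 ^ 2) \<Rightarrow> bool" where
  "uniformly_positive_definite_on S D \<longleftrightarrow>
     (\<exists>l>0. \<forall>p\<in>S. \<forall>\<xi> :: real ^ 2. inner \<xi> (D p *v \<xi>) \<ge> l * (norm \<xi>)\<^sup>2)"


definition beta1 :: real where "beta1 = pi / 4"
definition beta2 :: real where "beta2 = - (pi / 4)"

definition dir :: "real \<Rightarrow> real \<times> real" where
  "dir \<beta> = (cos \<beta>, sin \<beta>)"

text \<open>
  Coefficients of the splitting of \<open>\<nabla> \<cdot> (D \<nabla> u)\<close>, where \<open>D\<close> has the rows \<open>(a, b)\<close> and \<open>(b, c)\<close>,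
  into one-dimensional terms \<open>\<partial>\<^sub>e (\<gamma> \<partial>\<^sub>e u)\<close> along the two axes and the two diagonals.
  At each point at most one of the two diagonal coefficients is nonzero, according
  to the sign of \<open>b\<close>.
\<close>

definition gamma0 :: "('p \<Rightarrow> real) \<Rightarrow> ('p \<Rightarrow> real) \<Rightarrow> 'p \<Rightarrow> real" where
  "gamma0 a b p = (if b p \<ge> 0 then a p - b p * cot beta1 else a p - b p * cot beta2)"

definition gamma1_plus :: "('p \<Rightarrow> real) \<Rightarrow> 'p \<Rightarrow> real" where
  "gamma1_plus b p = (if b p \<ge> 0 then b p / (cos beta1 * sin beta1) else 0)"

definition gamma1_minus :: "('p \<Rightarrow> real) \<Rightarrow> 'p \<Rightarrow> real" where
  "gamma1_minus b p = (if b p \<ge> 0 then 0 else b p / (cos beta2 * sin beta2))"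

definition gamma2 :: "('p \<Rightarrow> real) \<Rightarrow> ('p \<Rightarrow> real) \<Rightarrow> 'p \<Rightarrow> real" where
  "gamma2 b c p = (if b p \<ge> 0 then c p - b p * tan beta1 else c p - b p * tan beta2)"

text \<open>
  Mesh functions are functions on points of the plane; for the steps \<open>s\<close> used below, \<open>P \<plusminus> s e\<close> are
  mesh points of the three-by-three stencil around \<open>P\<close>.
\<close>

definition central_difference ::
    "(real \<times> real \<Rightarrow> real) \<Rightarrow> real \<Rightarrow> real \<times> real \<Rightarrow> (real \<times> real \<Rightarrow> real) \<Rightarrow> real \<times> real \<Rightarrow> real" where
  "central_difference \<gamma> s e u P =
     1 / s\<^sup>2 * (\<gamma> (P + (s / 2) *\<^sub>R e) * (u (P + s *\<^sub>R e) - u P)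
              - \<gamma> (P - (s / 2) *\<^sub>R e) * (u P - u (P - s *\<^sub>R e)))"

definition scheme_operator ::
    "(real \<times> real \<Rightarrow> real) \<Rightarrow> (real \<times> real \<Rightarrow> real) \<Rightarrow> (real \<times> real \<Rightarrow> real) \<Rightarrow> real
      \<Rightarrow> (real \<times> real \<Rightarrow> real) \<Rightarrow> real \<times> real \<Rightarrow> real" where
  "scheme_operator a b c h u P =
     - (central_difference (gamma0 a b) h (1, 0) u P
        + central_difference (gamma1_plus b) (sqrt 2 * h) (dir beta1) u P
        + central_difference (gamma1_minus b) (sqrt 2 * h) (dir beta2) u P
        + central_difference (gamma2 b c) h (0, 1) u P)"


definition mesh_point :: "nat \<Rightarrow> nat \<Rightarrow> nat \<Rightarrow> real \<times> real" where
  "mesh_point N j k = (real j * (1 / real N), real k * (1 / real N))"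

text \<open>
  The \<open>(N - 1)\<^sup>2\<close> interior mesh points, with indices \<open>1 \<le> j, k \<le> N - 1\<close>, numbered row by row
  from \<open>0\<close>.
\<close>

definition num_unknowns :: "nat \<Rightarrow> nat" where
  "num_unknowns N = (N - 1) * (N - 1)"

definition interior_mesh_point :: "nat \<Rightarrow> nat \<Rightarrow> real \<times> real" where
  "interior_mesh_point N i = mesh_point N (i mod (N - 1) + 1) (i div (N - 1) + 1)"

definition satisfies_boundary_values ::
    "nat \<Rightarrow> (real \<times> real \<Rightarrow> real) \<Rightarrow> (real \<times> real \<Rightarrow> real) \<Rightarrow> bool" where
  "satisfies_boundary_values N g u \<longleftrightarrow>
     (\<forall>j\<le>N. \<forall>k\<le>N. mesh_point N j k \<in> frontier Omega
        \<longrightarrow> u (mesh_point N j k) = g (mesh_point N j k))"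

definition unknowns :: "nat \<Rightarrow> (real \<times> real \<Rightarrow> real) \<Rightarrow> real vec" where
  "unknowns N u = vec (num_unknowns N) (\<lambda>i. u (interior_mesh_point N i))"

text \<open>
  \<open>A\<close> is the coefficient matrix of the linear system for the interior unknowns if, after the
  boundary values have been inserted, the equation at the \<open>i\<close>-th interior mesh point is
  \<open>(A U)\<^sub>i = r\<^sub>i\<close> with a right-hand side \<open>r\<close> that does not depend on the unknowns \<open>U\<close>. Both sides
  of the equation are matched as affine functions of \<open>U\<close>, not just up to equivalence of the
  equations; as the interior values of \<open>u\<close> are arbitrary, this determines \<open>A\<close> uniquely.
\<close>

definition is_coefficient_matrix ::
    "(real \<times> real \<Rightarrow> real) \<Rightarrow> (real \<times> real \<Rightarrow> real) \<Rightarrow> (real \<times> real \<Rightarrow> real)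
      \<Rightarrow> (real \<times> real \<Rightarrow> real) \<Rightarrow> (real \<times> real \<Rightarrow> real) \<Rightarrow> nat \<Rightarrow> real mat \<Rightarrow> bool" where
  "is_coefficient_matrix a b c f g N A \<longleftrightarrow>
     A \<in> carrier_mat (num_unknowns N) (num_unknowns N) \<and>
     (\<exists>r \<in> carrier_vec (num_unknowns N).
        \<forall>u. satisfies_boundary_values N g u \<longrightarrow>
          (\<forall>i<num_unknowns N.
             scheme_operator a b c (1 / real N) u (interior_mesh_point N i)
               - f (interior_mesh_point N i)
             = vec_index (A *\<^sub>v unknowns N u) i - vec_index r i))"

definition M_matrix :: "real mat \<Rightarrow> bool" where
  "M_matrix A \<longleftrightarrow>
     square_mat A \<and>
     (\<forall>i<dim_row A. \<forall>j<dim_col A. i \<noteq> j \<longrightarrow> A $$ (i, j) \<le> 0) \<and>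
     (\<exists>B. inverts_mat A B \<and> inverts_mat B A \<and>
          (\<forall>i<dim_row B. \<forall>j<dim_col B. 0 \<le> B $$ (i, j)))"

definition monotone_scheme ::
    "(real \<times> real \<Rightarrow> real) \<Rightarrow> (real \<times> real \<Rightarrow> real) \<Rightarrow> (real \<times> real \<Rightarrow> real)
      \<Rightarrow> (real \<times> real \<Rightarrow> real) \<Rightarrow> (real \<times> real \<Rightarrow> real) \<Rightarrow> nat \<Rightarrow> bool" where
  "monotone_scheme a b c f g N \<longleftrightarrow>
     (\<exists>A. is_coefficient_matrix a b c f g N A \<and> M_matrix A)"

end

theory Submission imports Defs "Jordan_Normal_Form.Determinant" begin

text \<open>
  Since \<open>cot \<beta>\<^sub>1 = tan \<beta>\<^sub>1 = 1\<close>, \<open>cot \<beta>\<^sub>2 = tan \<beta>\<^sub>2 = -1\<close> and \<open>cos \<beta> sin \<beta> = \<plusminus> 1 / 2\<close>, the coefficients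
  of the splitting are \<open>\<gamma>\<^sub>0 = a - \<bar>b\<bar>\<close>, \<open>\<gamma>\<^sub>2 = c - \<bar>b\<bar>\<close>, \<open>\<gamma>\<^sub>1\<^sup>+ = 2 max b 0\<close> and
  \<open>\<gamma>\<^sub>1\<^sup>- = 2 max (-b) 0\<close>. The diagonal ones are nonnegative everywhere, and the hypotheses on \<open>a\<close> and
  \<open>c\<close> say exactly that the axial ones are positive on \<open>\<Omega>\<close>. A central difference at an interior
  mesh point samples its coefficient half-way to a neighbour, hence inside the open square, even if
  that neighbour lies on the boundary. So the scheme is a weighted sum
  \<open>\<Sum>\<^sub>Q w\<^sub>Q (u P - u Q)\<close> over the eight neighbours with all weights nonnegative and the four axial
  ones positive, for every mesh size (\<open>scheme_operator_eq\<close>, \<open>stencil_strong_minimum_principle\<close>).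

  Nonpositive off-diagonal entries are immediate from this form. For the inverse, it is enough that
  \<open>A v \<ge> 0\<close> forces \<open>v \<ge> 0\<close> (\<open>M_matrix_if_inverse_positive\<close>), which is a discrete minimum
  principle (\<open>scheme_matrix_inverse_positive\<close>). Extend \<open>v\<close> by zero to the boundary and suppose that
  its minimum is negative. At a minimiser every term of the weighted sum is nonpositive and the sum
  is nonnegative, so all terms vanish; as the weight of the western neighbour is positive, that
  neighbour is a minimiser too. Walking west reaches the boundary, where the extension is zero, a
  contradiction. In the row-by-row numbering a western neighbour has the preceding index, so it
  suffices to start at the minimiser of least index.

  The coefficient matrix itself is obtained by applying the difference operator to the indicator
  functions of the interior mesh points; linearity turns the matrix-vector product into the operator
  applied to the extension by zero (\<open>scheme_matrix_mult\<close>), and the boundary data contribute to the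
  right-hand side only.
\<close>

section \<open>The difference operator as a weighted sum over neighbours\<close>

lemma gamma_simps:
  "gamma0 a b p = a p - \<bar>b p\<bar>" "gamma1_plus b p = 2 * max (b p) 0"
  "gamma1_minus b p = 2 * max (- b p) 0" "gamma2 b c p = c p - \<bar>b p\<bar>"
  by (auto simp: gamma0_def gamma1_plus_def gamma1_minus_def gamma2_def beta1_def beta2_def
      cot_def cos_45 sin_45 tan_45 field_simps)

text \<open>
  Both differences are written as centre minus neighbour, so that nonnegative coefficients give
  nonnegative weights.
\<close>

lemma central_difference_outward:
  "central_difference \<gamma> s e u P = - (1 / s\<^sup>2 * (
     \<gamma> (P + (s / 2) *\<^sub>R e) * (u P - u (P + s *\<^sub>R e))
   + \<gamma> (P - (s / 2) *\<^sub>R e) * (u P - u (P - s *\<^sub>R e))))"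
  by (simp only: central_difference_def algebra_simps)

text \<open>
  The diagonal step \<open>\<surd>2 h\<close> cancels the factor \<open>1 / \<surd>2\<close> in the unit direction, so the nodes become
  \<open>P \<plusminus> (h, \<plusminus>h)\<close>; its square accounts for the halved diagonal weights.
\<close>

lemma scheme_operator_eq:
  assumes "h > 0"
  shows "scheme_operator a b c h u (x, y) = 1 / h\<^sup>2 *
     (gamma0 a b (x + h / 2, y) * (u (x, y) - u (x + h, y))
    + gamma0 a b (x - h / 2, y) * (u (x, y) - u (x - h, y))
    + gamma1_plus b (x + h / 2, y + h / 2) / 2 * (u (x, y) - u (x + h, y + h))
    + gamma1_plus b (x - h / 2, y - h / 2) / 2 * (u (x, y) - u (x - h, y - h))
    + gamma1_minus b (x + h / 2, y - h / 2) / 2 * (u (x, y) - u (x + h, y - h))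
    + gamma1_minus b (x - h / 2, y + h / 2) / 2 * (u (x, y) - u (x - h, y + h))
    + gamma2 b c (x, y + h / 2) * (u (x, y) - u (x, y + h))
    + gamma2 b c (x, y - h / 2) * (u (x, y) - u (x, y - h)))"
proof -
  have diag: "(sqrt 2 * h) *\<^sub>R dir beta1 = (h, h)" "(sqrt 2 * h / 2) *\<^sub>R dir beta1 = (h / 2, h / 2)"
    "(sqrt 2 * h) *\<^sub>R dir beta2 = (h, - h)" "(sqrt 2 * h / 2) *\<^sub>R dir beta2 = (h / 2, - (h / 2))"
    by (simp_all add: dir_def beta1_def beta2_def cos_45 sin_45)
  define k where "k = 1 / h\<^sup>2"
  have k: "1 / (sqrt 2 * h)\<^sup>2 = k / 2" by (simp add: k_def power_mult_distrib)
  show ?thesis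
    unfolding scheme_operator_def central_difference_outward diag k k_def[symmetric]
    by (simp add: distrib_left)
qed

definition stencil :: "real \<Rightarrow> real \<times> real \<Rightarrow> (real \<times> real) set" where
  "stencil h P = {P + (h * r, h * s) | r s. r \<in> {-1, 0, 1} \<and> s \<in> {-1, 0, 1}}"

lemma stencil_memI:
  "(x, y) \<in> stencil h (x, y)"
  "(x + h, y) \<in> stencil h (x, y)" "(x - h, y) \<in> stencil h (x, y)"
  "(x + h, y + h) \<in> stencil h (x, y)" "(x - h, y - h) \<in> stencil h (x, y)"
  "(x + h, y - h) \<in> stencil h (x, y)" "(x - h, y + h) \<in> stencil h (x, y)"
  "(x, y + h) \<in> stencil h (x, y)" "(x, y - h) \<in> stencil h (x, y)"
  unfolding stencil_def by (force simp: algebra_simps)+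

text \<open>
  Mesh functions are functions on the whole plane; only their values on the stencil matter.
\<close>

lemma scheme_operator_cong:
  assumes "h > 0" and eq: "\<And>Q. Q \<in> stencil h P \<Longrightarrow> u Q = v Q"
  shows "scheme_operator a b c h u P = scheme_operator a b c h v P"
proof -
  obtain x y where P: "P = (x, y)" by fastforce
  show ?thesis
    unfolding P scheme_operator_eq[OF assms(1)]
    using stencil_memI[THEN eq[unfolded P]] by simp
qed

lemma central_difference_add:
  "central_difference \<gamma> s e (\<lambda>Q. u Q + v Q) P
    = central_difference \<gamma> s e u P + central_difference \<gamma> s e v P"
  by (simp only: central_difference_def algebra_simps)

lemma central_difference_cmult:
  "central_difference \<gamma> s e (\<lambda>Q. k * u Q) P = k * central_difference \<gamma> s e u P"
  by (simp only: central_difference_def algebra_simps)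

lemma scheme_operator_add:
  "scheme_operator a b c h (\<lambda>Q. u Q + v Q) P
    = scheme_operator a b c h u P + scheme_operator a b c h v P"
  by (simp add: scheme_operator_def central_difference_add)

lemma scheme_operator_cmult:
  "scheme_operator a b c h (\<lambda>Q. k * u Q) P = k * scheme_operator a b c h u P"
  by (simp add: scheme_operator_def central_difference_cmult algebra_simps)

lemma scheme_operator_zero: "scheme_operator a b c h (\<lambda>Q. 0) P = 0"
  by (simp add: scheme_operator_def central_difference_def)

lemma scheme_operator_sum:
  assumes "finite I"
  shows "scheme_operator a b c h (\<lambda>Q. \<Sum>i\<in>I. x i * \<phi> i Q) P
    = (\<Sum>i\<in>I. x i * scheme_operator a b c h (\<phi> i) P)"
  using assms
  by induction (simp_all add: scheme_operator_zero scheme_operator_add scheme_operator_cmult)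

section \<open>The minimum principle on one stencil\<close>

lemma weighted_difference_nonpos:
  fixes w u v :: real
  assumes "0 \<le> w" "u \<le> v" shows "w * (u - v) \<le> 0"
  using assms by (simp add: mult_nonneg_nonpos)

text \<open>
  At a minimum over the stencil each of the eight weighted differences is nonpositive. The second
  part is the discrete strong principle in the one direction that is used later: if the sum is
  nonnegative then every term is zero, and the positive weight \<open>\<gamma>\<^sub>0\<close> towards the west passes the
  minimum on. The bounds on \<open>x\<close> and \<open>y\<close> allow neighbours on the boundary but keep all sampling points
  in the open square.
\<close>

lemma stencil_strong_minimum_principle:
  assumes h: "h > 0"
    and a_gt: "\<And>p. p \<in> Omega \<Longrightarrow> a p > \<bar>b p\<bar>"
    and c_gt: "\<And>p. p \<in> Omega \<Longrightarrow> c p > \<bar>b p\<bar>"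
    and inside: "h \<le> x" "x \<le> 1 - h" "h \<le> y" "y \<le> 1 - h"
    and min: "\<And>Q. Q \<in> stencil h (x, y) \<Longrightarrow> u (x, y) \<le> u Q"
  shows "scheme_operator a b c h u (x, y) \<le> 0"
    and "0 \<le> scheme_operator a b c h u (x, y) \<Longrightarrow> u (x - h, y) = u (x, y)"
proof -
  have in_Omega: "(x + r, y + s) \<in> Omega" if "\<bar>r\<bar> \<le> h / 2" "\<bar>s\<bar> \<le> h / 2" for r s
    using that inside h by (auto simp: Omega_def abs_le_iff)
  have g0: "0 < gamma0 a b (x + r, y + s)" and g2: "0 < gamma2 b c (x + r, y + s)"
    if "\<bar>r\<bar> \<le> h / 2" "\<bar>s\<bar> \<le> h / 2" for r s
    using a_gt[OF in_Omega[OF that]] c_gt[OF in_Omega[OF that]] by (simp_all add: gamma_simps)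
  have g1: "0 \<le> gamma1_plus b p / 2" "0 \<le> gamma1_minus b p / 2" for p
    by (simp_all add: gamma_simps)
  note le = stencil_memI[THEN min]
  define west where "west = gamma0 a b (x - h / 2, y) * (u (x, y) - u (x - h, y))"
  define others where "others =
      gamma0 a b (x + h / 2, y) * (u (x, y) - u (x + h, y))
    + gamma1_plus b (x + h / 2, y + h / 2) / 2 * (u (x, y) - u (x + h, y + h))
    + gamma1_plus b (x - h / 2, y - h / 2) / 2 * (u (x, y) - u (x - h, y - h))
    + gamma1_minus b (x + h / 2, y - h / 2) / 2 * (u (x, y) - u (x + h, y - h))
    + gamma1_minus b (x - h / 2, y + h / 2) / 2 * (u (x, y) - u (x - h, y + h))
    + gamma2 b c (x, y + h / 2) * (u (x, y) - u (x, y + h))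
    + gamma2 b c (x, y - h / 2) * (u (x, y) - u (x, y - h))"
  have split: "scheme_operator a b c h u (x, y) = 1 / h\<^sup>2 * (west + others)"
    unfolding scheme_operator_eq[OF h] west_def others_def by (simp only: ac_simps)
  have west_pos: "0 < gamma0 a b (x - h / 2, y)"
    using g0[of "- (h / 2)" 0] h by simp
  have west: "west \<le> 0"
    unfolding west_def using west_pos le(3) by (intro weighted_difference_nonpos) auto
  have others: "others \<le> 0"
    unfolding others_def
    using g0[of "h / 2" 0] g2[of 0 "h / 2"] g2[of 0 "- (h / 2)"] h
    by (intro add_nonpos_nonpos weighted_difference_nonpos le g1) simp_all
  show "scheme_operator a b c h u (x, y) \<le> 0"
    unfolding split using west others by (intro mult_nonneg_nonpos) simp_all
  assume "0 \<le> scheme_operator a b c h u (x, y)"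
  then have "0 \<le> west + others"
    unfolding split using h by (simp add: zero_le_divide_iff)
  then have "west = 0" using west others by linarith
  then show "u (x - h, y) = u (x, y)"
    using west_pos by (simp add: west_def)
qed

section \<open>Mesh points and their numbering\<close>

lemma frontier_Omega: "frontier Omega = {0..1} \<times> {0..1} - Omega"
proof -
  have "open Omega" by (simp add: Omega_def open_Times)
  then show ?thesis
    by (simp add: frontier_def interior_open) (simp add: Omega_def closure_Times)
qed

text \<open>
  Rows have length \<open>N - 1\<close> and both mesh coordinates start at \<open>1\<close>, which explains the shifts: moving
  one point west lowers the index by one.
\<close>

lemma interior_mesh_point_index:
  assumes "1 \<le> j" "j < N" "1 \<le> k" "k < N"
  shows "(j - 1) + (k - 1) * (N - 1) < num_unknowns N"
    and "interior_mesh_point N ((j - 1) + (k - 1) * (N - 1)) = mesh_point N j k"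
proof -
  have "(j - 1) + (k - 1) * (N - 1) < (N - 1) + (k - 1) * (N - 1)" using assms by simp
  also have "\<dots> = k * (N - 1)" using assms by (cases k) simp_all
  also have "\<dots> \<le> (N - 1) * (N - 1)" using assms by (intro mult_right_mono) auto
  finally show "(j - 1) + (k - 1) * (N - 1) < num_unknowns N" by (simp add: num_unknowns_def)
  have "j - 1 < N - 1" using assms by simp
  then have "((j - 1) + (k - 1) * (N - 1)) mod (N - 1) = j - 1"
    "((j - 1) + (k - 1) * (N - 1)) div (N - 1) = k - 1"
    by (simp_all only: mod_mult_self1 mod_less div_mult_self1 div_less less_nat_zero_code
        neq0_conv)
  then show "interior_mesh_point N ((j - 1) + (k - 1) * (N - 1)) = mesh_point N j k"
    using assms unfolding interior_mesh_point_def by simp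
qed

lemma interior_mesh_point_cases:
  assumes "i < num_unknowns N"
  obtains j k where "1 \<le> j" "j < N" "1 \<le> k" "k < N"
    "i = (j - 1) + (k - 1) * (N - 1)" "interior_mesh_point N i = mesh_point N j k"
proof
  have "0 < N - 1" using assms by (cases "N - 1") (auto simp: num_unknowns_def)
  moreover have "i div (N - 1) < N - 1"
    using assms by (simp add: num_unknowns_def less_mult_imp_div_less)
  ultimately show "i mod (N - 1) + 1 < N" "i div (N - 1) + 1 < N"
    using mod_less_divisor[of "N - 1" i] by linarith+
  show "i = (i mod (N - 1) + 1 - 1) + (i div (N - 1) + 1 - 1) * (N - 1)"
    by (simp only: add_diff_cancel_right' mod_div_mult_eq)
qed (simp_all add: interior_mesh_point_def)

lemma mesh_point_inject:
  assumes "N > 0" shows "mesh_point N j k = mesh_point N j' k' \<longleftrightarrow> j = j' \<and> k = k'"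
  using assms by (simp add: mesh_point_def)

lemma inj_interior_mesh_point: "inj_on (interior_mesh_point N) {..<num_unknowns N}"
proof (rule inj_onI)
  fix i i' assume *: "i \<in> {..<num_unknowns N}" "i' \<in> {..<num_unknowns N}"
    and eq: "interior_mesh_point N i = interior_mesh_point N i'"
  have "N > 0" using * by (cases N) (auto simp: num_unknowns_def)
  then show "i = i'"
    using * eq by (auto elim!: interior_mesh_point_cases simp: mesh_point_inject)
qed

lemma stencil_mesh_point:
  assumes jk: "1 \<le> j" "j < N" "1 \<le> k" "k < N" and Q: "Q \<in> stencil (1 / real N) (mesh_point N j k)"
  obtains j' k' where "j' \<le> N" "k' \<le> N" "Q = mesh_point N j' k'"
proof -
  have shift: "\<exists>j'\<le>N. (real j * (1 / real N) + 1 / real N * r) = real j' * (1 / real N)"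
    if "1 \<le> j" "j < N" "r \<in> {-1, 0, 1}" for j and r :: real
  proof -
    have "real j + r = real (if r = -1 then j - 1 else if r = 0 then j else j + 1)"
      using that by (auto simp: of_nat_diff)
    then have "\<exists>j'\<le>N. real j + r = real j'"
      using that by (intro exI[of _ "if r = -1 then j - 1 else if r = 0 then j else j + 1"]) auto
    then show ?thesis by (metis distrib_left mult.commute)
  qed
  from Q obtain r s where rs: "r \<in> {-1, 0, 1}" "s \<in> {-1, 0, 1}"
    and Q_eq: "Q = mesh_point N j k + (1 / real N * r, 1 / real N * s)"
    by (auto simp: stencil_def)
  then show ?thesis
    using shift[OF jk(1,2) rs(1)] shift[OF jk(3,4) rs(2)] that
    by (auto simp: mesh_point_def)
qed

lemma mesh_point_in_Omega_iff:
  assumes "N > 0" shows "mesh_point N j k \<in> Omega \<longleftrightarrow> 1 \<le> j \<and> j < N \<and> 1 \<le> k \<and> k < N"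
  using assms by (auto simp: mesh_point_def Omega_def zero_less_divide_iff Suc_le_eq)

lemma mesh_coordinate_bounds:
  assumes "1 \<le> j" "j < N"
  shows "1 / real N \<le> real j * (1 / real N)" "real j * (1 / real N) \<le> 1 - 1 / real N"
proof -
  have "1 \<le> real j" "real j + 1 \<le> real N" using assms by simp_all
  then have "1 / real N \<le> real j / real N" "(real j + 1) / real N \<le> 1"
    by (simp_all add: divide_right_mono)
  then show "1 / real N \<le> real j * (1 / real N)" "real j * (1 / real N) \<le> 1 - 1 / real N"
    by (simp_all add: add_divide_distrib)
qed

lemma mesh_point_in_frontier:
  assumes "N > 0" "j \<le> N" "k \<le> N" "mesh_point N j k \<notin> Omega"
  shows "mesh_point N j k \<in> frontier Omega"
  using assms by (simp add: frontier_Omega) (simp add: mesh_point_def)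

lemma interior_mesh_point_in_Omega:
  "i < num_unknowns N \<Longrightarrow> interior_mesh_point N i \<in> Omega"
  by (erule interior_mesh_point_cases) (simp add: mesh_point_in_Omega_iff)

section \<open>The coefficient matrix\<close>

text \<open>
  The extension by zero: \<open>v\<close> gives the values at the interior mesh points, and the boundary mesh
  points carry homogeneous Dirichlet data.
\<close>

definition mesh_function :: "nat \<Rightarrow> real vec \<Rightarrow> real \<times> real \<Rightarrow> real" where
  "mesh_function N v Q =
     (\<Sum>i<num_unknowns N. vec_index v i * of_bool (Q = interior_mesh_point N i))"

lemma mesh_function_interior:
  assumes "i < num_unknowns N"
  shows "mesh_function N v (interior_mesh_point N i) = vec_index v i"
proof -
  have "mesh_function N v (interior_mesh_point N i)
      = (\<Sum>j<num_unknowns N. if j = i then vec_index v j else 0)"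
    unfolding mesh_function_def
    using assms inj_onD[OF inj_interior_mesh_point] by (intro sum.cong) (auto simp: of_bool_def)
  then show ?thesis using assms by simp
qed

lemma mesh_function_elsewhere:
  "(\<And>i. i < num_unknowns N \<Longrightarrow> Q \<noteq> interior_mesh_point N i) \<Longrightarrow> mesh_function N v Q = 0"
  by (simp add: mesh_function_def)

definition scheme_matrix ::
    "(real \<times> real \<Rightarrow> real) \<Rightarrow> (real \<times> real \<Rightarrow> real) \<Rightarrow> (real \<times> real \<Rightarrow> real) \<Rightarrow> nat \<Rightarrow> real mat" where
  "scheme_matrix a b c N = mat (num_unknowns N) (num_unknowns N)
     (\<lambda>(i, j). scheme_operator a b c (1 / real N) (\<lambda>Q. of_bool (Q = interior_mesh_point N j))
        (interior_mesh_point N i))"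

lemma scheme_matrix_carrier:
  "scheme_matrix a b c N \<in> carrier_mat (num_unknowns N) (num_unknowns N)"
  by (simp add: scheme_matrix_def)

lemma scheme_matrix_mult:
  assumes "v \<in> carrier_vec (num_unknowns N)" "i < num_unknowns N"
  shows "vec_index (scheme_matrix a b c N *\<^sub>v v) i
    = scheme_operator a b c (1 / real N) (mesh_function N v) (interior_mesh_point N i)"
  using assms unfolding mesh_function_def scheme_operator_sum[OF finite_lessThan]
  by (simp add: scheme_matrix_def scalar_prod_def mult.commute atLeast0LessThan)

text \<open>
  On a stencil, an admissible \<open>u\<close> is the extension by zero of its unknowns plus the boundary data
  extended by zero into \<open>\<Omega>\<close>. By linearity the first summand yields the matrix-vector product, and
  the second one is free of unknowns and moves to the right-hand side.
\<close>

lemma scheme_matrix_is_coefficient_matrix: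
  "is_coefficient_matrix a b c f g N (scheme_matrix a b c N)"
  unfolding is_coefficient_matrix_def
proof (intro conjI bexI allI impI)
  let ?G = "\<lambda>Q. if Q \<in> Omega then 0 else g Q"
  let ?r = "vec (num_unknowns N) (\<lambda>i. f (interior_mesh_point N i)
    - scheme_operator a b c (1 / real N) ?G (interior_mesh_point N i))"
  show "?r \<in> carrier_vec (num_unknowns N)" by simp
  fix u i assume bv: "satisfies_boundary_values N g u" and i: "i < num_unknowns N"
  from i obtain j k where jk: "1 \<le> j" "j < N" "1 \<le> k" "k < N"
    and P: "interior_mesh_point N i = mesh_point N j k" by (rule interior_mesh_point_cases)
  have N: "N > 0" using jk by simp
  have decompose: "u Q = mesh_function N (unknowns N u) Q + ?G Q"
    if Q: "Q \<in> stencil (1 / real N) (mesh_point N j k)" for Q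
  proof -
    obtain j' k' where jk': "j' \<le> N" "k' \<le> N" and Q_eq: "Q = mesh_point N j' k'"
      using jk Q by (rule stencil_mesh_point)
    show ?thesis
    proof (cases "Q \<in> Omega")
      case True
      then obtain m where "m < num_unknowns N" "Q = interior_mesh_point N m"
        using N interior_mesh_point_index unfolding Q_eq
        by (metis mesh_point_in_Omega_iff)
      with True show ?thesis by (simp add: mesh_function_interior unknowns_def)
    next
      case False
      then have "u Q = g Q"
        using bv jk' N mesh_point_in_frontier unfolding Q_eq satisfies_boundary_values_def by blast
      moreover have "mesh_function N (unknowns N u) Q = 0"
        using False interior_mesh_point_in_Omega by (intro mesh_function_elsewhere) blast
      ultimately show ?thesis using False by simp
    qed
  qed
  have "scheme_operator a b c (1 / real N) u (interior_mesh_point N i)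
      = scheme_operator a b c (1 / real N) (\<lambda>Q. mesh_function N (unknowns N u) Q + ?G Q)
          (interior_mesh_point N i)"
    using N by (intro scheme_operator_cong decompose) (simp_all add: P)
  also have "\<dots> = vec_index (scheme_matrix a b c N *\<^sub>v unknowns N u) i
      + scheme_operator a b c (1 / real N) ?G (interior_mesh_point N i)"
    using i by (simp add: scheme_operator_add scheme_matrix_mult unknowns_def)
  finally show "scheme_operator a b c (1 / real N) u (interior_mesh_point N i)
       - f (interior_mesh_point N i)
     = vec_index (scheme_matrix a b c N *\<^sub>v unknowns N u) i - vec_index ?r i"
    using i by simp
qed (rule scheme_matrix_carrier)

section \<open>Monotonicity\<close>

text \<open>
  This is the global minimum principle for the extension by zero of \<open>v\<close>: a negative minimum would
  be carried from mesh point to mesh point westwards until it meets a zero boundary value.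
\<close>

lemma scheme_matrix_inverse_positive:
  assumes a_gt: "\<And>p. p \<in> Omega \<Longrightarrow> a p > \<bar>b p\<bar>"
    and c_gt: "\<And>p. p \<in> Omega \<Longrightarrow> c p > \<bar>b p\<bar>"
    and v: "v \<in> carrier_vec (num_unknowns N)"
    and Av: "\<And>i. i < num_unknowns N \<Longrightarrow> 0 \<le> vec_index (scheme_matrix a b c N *\<^sub>v v) i"
    and l: "l < num_unknowns N"
  shows "0 \<le> vec_index v l"
proof (rule ccontr)
  let ?u = "mesh_function N v"
  define \<mu> where "\<mu> = Min (vec_index v ` {..<num_unknowns N})"
  assume "\<not> 0 \<le> vec_index v l"
  then have neg: "\<mu> < 0" using l unfolding \<mu>_def by (subst Min_less_iff) (auto simp: not_le)
  have "\<mu> \<in> vec_index v ` {..<num_unknowns N}"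
    unfolding \<mu>_def using l by (intro Min_in) auto
  then have ex: "\<exists>i. i < num_unknowns N \<and> vec_index v i = \<mu>" by auto
  \<comment> \<open>The least index puts \<open>m\<close> as far west in its row as a minimiser can be.\<close>
  define m where "m = (LEAST i. i < num_unknowns N \<and> vec_index v i = \<mu>)"
  have m: "m < num_unknowns N" "vec_index v m = \<mu>"
    using LeastI_ex[OF ex] by (simp_all add: m_def)
  obtain j k where jk: "1 \<le> j" "j < N" "1 \<le> k" "k < N" and m_eq: "m = (j - 1) + (k - 1) * (N - 1)"
    and P: "interior_mesh_point N m = mesh_point N j k"
    using m(1) by (rule interior_mesh_point_cases)
  define h where "h = 1 / real N"
  have N: "N > 0" and h: "h > 0" using jk by (simp_all add: h_def)
  have uP: "?u (mesh_point N j k) = \<mu>" using mesh_function_interior[OF m(1), of v] m(2) P by simp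
  have min: "\<mu> \<le> ?u Q" for Q
  proof (cases "\<exists>i<num_unknowns N. Q = interior_mesh_point N i")
    case True
    then show ?thesis by (auto simp: mesh_function_interior \<mu>_def intro!: Min_le)
  next
    case False
    then show ?thesis using neg by (subst mesh_function_elsewhere) auto
  qed
  have "0 \<le> scheme_operator a b c h ?u (mesh_point N j k)"
    using Av[OF m(1)] scheme_matrix_mult[OF v m(1)] by (simp add: P h_def)
  then have "?u (real j * h - h, real k * h) = ?u (real j * h, real k * h)"
    using min uP unfolding mesh_point_def h_def[symmetric]
    by (intro stencil_strong_minimum_principle(2)[where a = a and b = b and c = c])
      (use h a_gt c_gt jk mesh_coordinate_bounds in \<open>simp_all add: h_def\<close>)
  moreover have "(real j * h - h, real k * h) = mesh_point N (j - 1) k"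
    using jk by (simp add: mesh_point_def h_def of_nat_diff algebra_simps diff_divide_distrib)
  ultimately have west: "?u (mesh_point N (j - 1) k) = \<mu>"
    using uP by (simp add: mesh_point_def h_def)
  show False
  proof (cases "j = 1")
    case True
    have "mesh_point N (j - 1) k \<notin> Omega" using True N by (simp add: mesh_point_in_Omega_iff)
    then have "?u (mesh_point N (j - 1) k) = 0"
      using interior_mesh_point_in_Omega by (intro mesh_function_elsewhere) metis
    then show False using west neg by simp
  next
    case False
    then have "1 \<le> j - 1" "j - 1 < N" using jk by auto
    note idx = interior_mesh_point_index[OF this jk(3,4)]
    have "vec_index v (j - 1 - 1 + (k - 1) * (N - 1)) = \<mu>"
      using mesh_function_interior[OF idx(1), of v, unfolded idx(2)] west by simp
    then have "m \<le> j - 1 - 1 + (k - 1) * (N - 1)"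
      unfolding m_def using idx(1) by (intro Least_le) simp
    then show False using False jk by (simp add: m_eq)
  qed
qed

text \<open>
  The indicator function of the \<open>l\<close>-th point vanishes at the \<open>i\<close>-th one, which is therefore a
  minimum of it.
\<close>

lemma scheme_matrix_offdiag_nonpos:
  assumes a_gt: "\<And>p. p \<in> Omega \<Longrightarrow> a p > \<bar>b p\<bar>"
    and c_gt: "\<And>p. p \<in> Omega \<Longrightarrow> c p > \<bar>b p\<bar>"
    and il: "i < num_unknowns N" "l < num_unknowns N" "i \<noteq> l"
  shows "scheme_matrix a b c N $$ (i, l) \<le> 0"
proof -
  obtain j k where jk: "1 \<le> j" "j < N" "1 \<le> k" "k < N" and P: "interior_mesh_point N i = mesh_point N j k"
    using il(1) by (rule interior_mesh_point_cases)
  have "interior_mesh_point N i \<noteq> interior_mesh_point N l"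
    using inj_onD[OF inj_interior_mesh_point, of N i l] il by auto
  then have "scheme_operator a b c (1 / real N) (\<lambda>Q. of_bool (Q = interior_mesh_point N l))
      (real j * (1 / real N), real k * (1 / real N)) \<le> 0"
    by (intro stencil_strong_minimum_principle(1))
      (use jk a_gt c_gt mesh_coordinate_bounds in \<open>simp_all add: P mesh_point_def\<close>)
  then show ?thesis using il by (simp add: scheme_matrix_def P mesh_point_def)
qed

text \<open>
  If \<open>A v \<ge> 0\<close> implies \<open>v \<ge> 0\<close>, then a kernel vector \<open>v\<close> satisfies \<open>v \<ge> 0\<close> and \<open>-v \<ge> 0\<close>, so \<open>A\<close> is
  invertible; and each column of the inverse is mapped by \<open>A\<close> to a unit vector, hence is nonnegative.
\<close>

lemma M_matrix_if_inverse_positive: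
  fixes A :: "real mat"
  assumes A: "A \<in> carrier_mat n n"
    and offdiag: "\<And>i j. i < n \<Longrightarrow> j < n \<Longrightarrow> i \<noteq> j \<Longrightarrow> A $$ (i, j) \<le> 0"
    and positive: "\<And>v i. \<lbrakk>v \<in> carrier_vec n; \<And>i. i < n \<Longrightarrow> 0 \<le> vec_index (A *\<^sub>v v) i; i < n\<rbrakk>
      \<Longrightarrow> 0 \<le> vec_index v i"
  shows "M_matrix A"
proof -
  have "Determinant.det A \<noteq> 0"
  proof
    assume "Determinant.det A = 0"
    then obtain v where v: "v \<in> carrier_vec n" "v \<noteq> 0\<^sub>v n" "A *\<^sub>v v = 0\<^sub>v n"
      using det_0_iff_vec_prod_zero[OF A] by blast
    have uminus: "- v = (- 1) \<cdot>\<^sub>v v" by (intro eq_vecI) simp_all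
    have Av': "A *\<^sub>v (- v) = 0\<^sub>v n"
      unfolding uminus mult_mat_vec[OF A v(1)] v(3) by (intro eq_vecI) simp_all
    have "vec_index v i = 0" if "i < n" for i
      using positive[of v i] positive[of "- v" i] v Av' that by simp
    then have "v = 0\<^sub>v n" using v(1) by (intro eq_vecI) auto
    with v(2) show False by simp
  qed
  from det_non_zero_imp_unit[OF A this, unfolded Units_def, of "()"]
  have "\<exists>B\<in>carrier_mat n n. B * A = 1\<^sub>m n \<and> A * B = 1\<^sub>m n"
    by (simp add: ring_mat_def)
  then obtain B where B: "B \<in> carrier_mat n n" "A * B = 1\<^sub>m n" "B * A = 1\<^sub>m n" by blast
  have "0 \<le> B $$ (i, j)" if ij: "i < n" "j < n" for i j
  proof -
    have "A *\<^sub>v col B j = unit_vec n j"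
      by (simp only: col_mult2[OF A B(1) ij(2), symmetric] B(2) col_one[OF ij(2)])
    moreover have "0 \<le> vec_index (unit_vec n j :: real vec) l" if "l < n" for l
      using that ij(2) by (simp only: index_unit_vec split: if_split) simp
    moreover have "col B j \<in> carrier_vec n" using B(1) by (intro carrier_vecI) simp
    ultimately have "0 \<le> vec_index (col B j) i" using positive[of "col B j" i] ij(1) by metis
    then show ?thesis using B(1) ij by (simp only: index_col carrier_matD)
  qed
  then have "\<exists>B. A * B = 1\<^sub>m (dim_row A) \<and> B * A = 1\<^sub>m (dim_row B) \<and>
      (\<forall>i<dim_row B. \<forall>j<dim_col B. 0 \<le> B $$ (i, j))"
    using B by (intro exI[of _ B]) (simp only: carrier_matD[OF A] carrier_matD[OF B(1)], blast)
  then show ?thesis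
    unfolding M_matrix_def inverts_mat_def square_mat.simps carrier_matD[OF A]
    using offdiag by blast
qed

theorem theorem3p2:
  fixes a b c f g :: "real \<times> real \<Rightarrow> real"
    and D :: "real \<times> real \<Rightarrow> real ^ 2 ^ 2"
  assumes D_eq: "\<And>p. p \<in> closure Omega \<Longrightarrow> D p = vector [vector [a p, b p], vector [b p, c p]]"
    and D_cont: "continuous_on (closure Omega) D"
    and D_sym: "\<And>p. p \<in> Omega \<Longrightarrow> Finite_Cartesian_Product.transpose (D p) = D p"
    and D_upd: "uniformly_positive_definite_on Omega D"
    and a_gt: "\<And>p. p \<in> Omega \<Longrightarrow> a p > \<bar>b p\<bar>"
    and c_gt: "\<And>p. p \<in> Omega \<Longrightarrow> c p > \<bar>b p\<bar>"
  shows "\<exists>h0>0. \<forall>N::nat. N \<ge> 1 \<and> 1 / real N \<le> h0 \<longrightarrow> monotone_scheme a b c f g N"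
proof -
  have "monotone_scheme a b c f g N" for N
    unfolding monotone_scheme_def
  proof (intro exI conjI)
    show "M_matrix (scheme_matrix a b c N)"
      using scheme_matrix_carrier scheme_matrix_offdiag_nonpos[OF a_gt c_gt]
        scheme_matrix_inverse_positive[OF a_gt c_gt]
      by (rule M_matrix_if_inverse_positive)
  qed (rule scheme_matrix_is_coefficient_matrix)
  \<comment> \<open>Every mesh is fine enough, so any positive bound on the mesh size will do.\<close>
  then show ?thesis by (intro exI[of _ 1]) simp
qed

end
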